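(* Let $(M,\omega)$, $\omega=d\theta$, be an exact symplectic manifold of dimension $2n$, let $H:M\to\mathbb{R}$ be a smooth function, and let $X_H$ be its Hamiltonian vector field, defined by $i_{X_H}\omega=-dH$. Let $U\subset M$ be a convex open set (in local coordinates) containing points $z_0$ and $z_h$ on the flow of $X_H$ (at times $0$ and $h$). Suppose a map $\rho:U\times U\to U$ is defined by $$\rho(z_0,z_h)=\left(\tfrac12 I_{2n}-b\right)z_0+\left(\tfrac12 I_{2n}+b\right)z_h,$$ where $b\in\mathbb{M}_{2n\times 2n}(\mathbb{R})$ is a Hamiltonian matrix, i.e. $b^TJ+Jb=0$. Then the map $z_0\mapsto z_h$ implicitly defined by $$z_h=z_0+h\,X_H\big(\rho(z_0,z_h)\big)$$ is symplectic.
   Context: One works in local coordinates $z=(z_1,\dots,z_{2n})$ on $U$ (so $U$ is identified with an open subset of $\mathbb{R}^{2n}$) in which $\omega=\sum_{i,j}\tfrac12 J_{ij}\,dz_j\wedge dz_i$ with a constant real matrix $J=[J_{ij}]$ satisfying $J^T=-J$ and $J^2=-I_{2n}$; in these coordinates $X_H=J\nabla H$. The number $h\in\mathbb{R}$ is the step size. An implicit map $z_0\mapsto z_h$ given by an equation $\Psi(z_0,z_h)=0$ (here $\Psi(z_0,z_h)=z_h-z_0-hX_H(\rho(z_0,z_h))$, with $z_0,z_h$ variable in $U$) is called symplectic if, writing $B_1=-\partial\Psi/\partial z_0$ and $B_2=\partial\Psi/\partial z_h$, the amplification matrix $B=B_2^{-1}B_1$ (the derivative of the implicitly defined map, at every solution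 where $B_2$ is invertible) is a symplectic matrix, i.e. $BJB^T=J$. *)

theory Defs
  imports "HOL-Analysis.Analysis"
begin

section \<open>Smooth manifolds\<close>

text \<open>Differentiability of order \<open>k\<close> and of all orders, meant for open sets \<open>S\<close>.\<close>

primrec Ck_on :: "nat \<Rightarrow> 'a::euclidean_space set \<Rightarrow> ('a \<Rightarrow> 'b::real_normed_vector) \<Rightarrow> bool"
  where
    "Ck_on 0 S f \<longleftrightarrow> continuous_on S f"
  | "Ck_on (Suc k) S f \<longleftrightarrow>
       (\<forall>x\<in>S. f differentiable at x) \<and>
       (\<forall>v. Ck_on k S (\<lambda>x. frechet_derivative f (at x) v))"

definition smooth_on :: "'a::euclidean_space set \<Rightarrow> ('a \<Rightarrow> 'b::real_normed_vector) \<Rightarrow> bool"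
  where "smooth_on S f \<longleftrightarrow> (\<forall>k. Ck_on k S f)"

text \<open>A chart is a domain together with a coordinate map, whose values outside the domain are
  irrelevant.\<close>

type_synonym ('m, 'd) chart = "'m set \<times> ('m \<Rightarrow> real ^ 'd)"

abbreviation chart_dom :: "('m, 'd::finite) chart \<Rightarrow> 'm set"
  where "chart_dom c \<equiv> fst c"

abbreviation chart_map :: "('m, 'd::finite) chart \<Rightarrow> 'm \<Rightarrow> real ^ 'd"
  where "chart_map c \<equiv> snd c"

definition chart_inv :: "('m, 'd::finite) chart \<Rightarrow> real ^ 'd \<Rightarrow> 'm"
  where "chart_inv c = inv_into (chart_dom c) (chart_map c)"

definition is_chart :: "'m topology \<Rightarrow> ('m, 'd::finite) chart \<Rightarrow> bool"
  where "is_chart M c \<longleftrightarrow>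
    openin M (chart_dom c) \<and> open (chart_map c ` chart_dom c) \<and>
    homeomorphic_map (subtopology M (chart_dom c))
      (top_of_set (chart_map c ` chart_dom c)) (chart_map c)"

definition transition ::
    "('m, 'd::finite) chart \<Rightarrow> ('m, 'd) chart \<Rightarrow> real ^ 'd \<Rightarrow> real ^ 'd"
  where "transition c c' = chart_map c' \<circ> chart_inv c"

text \<open>The atlas is not required to be maximal; in particular it may be a maximal one. The
  dimension of the manifold is \<open>CARD('d)\<close>.\<close>

definition smooth_manifold :: "'m topology \<Rightarrow> ('m, 'd::finite) chart set \<Rightarrow> bool"
  where "smooth_manifold M A \<longleftrightarrow>
    Hausdorff_space M \<and> second_countable M \<and>
    (\<forall>c\<in>A. is_chart M c) \<and> (\<Union>c\<in>A. chart_dom c) = topspace M \<and>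
    (\<forall>c\<in>A. \<forall>c'\<in>A.
       smooth_on (chart_map c ` (chart_dom c \<inter> chart_dom c')) (transition c c'))"

definition smooth_function :: "('m, 'd::finite) chart set \<Rightarrow> ('m \<Rightarrow> real) \<Rightarrow> bool"
  where "smooth_function A H \<longleftrightarrow>
    (\<forall>c\<in>A. smooth_on (chart_map c ` chart_dom c) (H \<circ> chart_inv c))"

section \<open>Vector fields and differential forms\<close>

text \<open>A tensor field is given by its components in every chart of the atlas: \<open>X c p\<close>,
  \<open>\<theta> c p\<close> and \<open>\<omega> c p\<close> are the values at the point \<open>p\<close> with respect to the coordinates of
  the chart \<open>c\<close>, tangent vectors at \<open>p\<close> being represented by their components in \<open>real ^ 'd\<close>.
  The components in two charts are related by the derivative of the transition map.\<close>

type_synonym ('m, 'd) vfield = "('m, 'd) chart \<Rightarrow> 'm \<Rightarrow> real ^ 'd"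
type_synonym ('m, 'd) form1 = "('m, 'd) chart \<Rightarrow> 'm \<Rightarrow> real ^ 'd \<Rightarrow> real"
type_synonym ('m, 'd) form2 = "('m, 'd) chart \<Rightarrow> 'm \<Rightarrow> real ^ 'd \<Rightarrow> real ^ 'd \<Rightarrow> real"

definition tangent_transition ::
    "('m, 'd::finite) chart \<Rightarrow> ('m, 'd) chart \<Rightarrow> 'm \<Rightarrow> real ^ 'd \<Rightarrow> real ^ 'd"
  where "tangent_transition c c' p =
    frechet_derivative (transition c c') (at (chart_map c p))"

definition vector_field :: "('m, 'd::finite) chart set \<Rightarrow> ('m, 'd) vfield \<Rightarrow> bool"
  where "vector_field A X \<longleftrightarrow>
    (\<forall>c\<in>A. smooth_on (chart_map c ` chart_dom c) (X c \<circ> chart_inv c)) \<and>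
    (\<forall>c\<in>A. \<forall>c'\<in>A. \<forall>p \<in> chart_dom c \<inter> chart_dom c'.
       X c' p = tangent_transition c c' p (X c p))"

definition one_form :: "('m, 'd::finite) chart set \<Rightarrow> ('m, 'd) form1 \<Rightarrow> bool"
  where "one_form A \<theta> \<longleftrightarrow>
    (\<forall>c\<in>A. (\<forall>p\<in>chart_dom c. linear (\<theta> c p)) \<and>
       (\<forall>v. smooth_on (chart_map c ` chart_dom c) (\<lambda>x. \<theta> c (chart_inv c x) v))) \<and>
    (\<forall>c\<in>A. \<forall>c'\<in>A. \<forall>p \<in> chart_dom c \<inter> chart_dom c'. \<forall>v.
       \<theta> c p v = \<theta> c' p (tangent_transition c c' p v))"

text \<open>The value at constant vector fields \<open>u\<close>, \<open>v\<close>, so that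
  \<open>d\<theta>(u, v) = u(\<theta>(v)) - v(\<theta>(u))\<close>.\<close>

definition ext_deriv :: "('m, 'd::finite) form1 \<Rightarrow> ('m, 'd) form2"
  where "ext_deriv \<theta> c p u v =
    frechet_derivative (\<lambda>x. \<theta> c (chart_inv c x) v) (at (chart_map c p)) u -
    frechet_derivative (\<lambda>x. \<theta> c (chart_inv c x) u) (at (chart_map c p)) v"

definition exact_symplectic_manifold ::
    "'m topology \<Rightarrow> ('m, 'd::finite) chart set \<Rightarrow> ('m, 'd) form1 \<Rightarrow> ('m, 'd) form2 \<Rightarrow> bool"
  where "exact_symplectic_manifold M A \<theta> \<omega> \<longleftrightarrow>
    smooth_manifold M A \<and> one_form A \<theta> \<and>
    (\<forall>c\<in>A. \<forall>p\<in>chart_dom c.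
       \<omega> c p = ext_deriv \<theta> c p \<and>
       (\<forall>u. (\<forall>v. \<omega> c p u v = 0) \<longrightarrow> u = 0))"

definition differential :: "('m \<Rightarrow> real) \<Rightarrow> ('m, 'd::finite) form1"
  where "differential H c p = frechet_derivative (H \<circ> chart_inv c) (at (chart_map c p))"

definition hamiltonian_vector_field ::
    "('m, 'd::finite) chart set \<Rightarrow> ('m, 'd) form2 \<Rightarrow> ('m \<Rightarrow> real) \<Rightarrow> ('m, 'd) vfield \<Rightarrow> bool"
  where "hamiltonian_vector_field A \<omega> H X \<longleftrightarrow>
    vector_field A X \<and>
    (\<forall>c\<in>A. \<forall>p\<in>chart_dom c. \<forall>v. \<omega> c p (X c p) v = - differential H c p v)"

definition integral_curve ::
    "'m topology \<Rightarrow> ('m, 'd::finite) chart set \<Rightarrow> ('m, 'd) vfield \<Rightarrow> real set \<Rightarrow> (real \<Rightarrow> 'm) \<Rightarrow> bool"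
  where "integral_curve M A X I \<gamma> \<longleftrightarrow>
    continuous_map (top_of_set I) M \<gamma> \<and>
    (\<forall>t\<in>I. \<forall>c\<in>A. \<gamma> t \<in> chart_dom c \<longrightarrow>
       ((chart_map c \<circ> \<gamma>) has_vector_derivative X c (\<gamma> t)) (at t within I))"

section \<open>Linear symplectic algebra and the implicit scheme\<close>

definition wedge :: "(real ^ 'd \<Rightarrow> real) \<Rightarrow> (real ^ 'd \<Rightarrow> real) \<Rightarrow> real ^ 'd \<Rightarrow> real ^ 'd \<Rightarrow> real"
  where "wedge \<alpha> \<beta> u v = \<alpha> u * \<beta> v - \<alpha> v * \<beta> u"

definition const_two_form :: "real ^ 'd ^ 'd \<Rightarrow> real ^ 'd \<Rightarrow> real ^ 'd::finite \<Rightarrow> real"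
  where "const_two_form J u v =
    (\<Sum>i\<in>UNIV. \<Sum>j\<in>UNIV. 1/2 * J $ i $ j * wedge (\<lambda>w. w $ j) (\<lambda>w. w $ i) u v)"

definition hamiltonian_matrix :: "real ^ 'd ^ 'd \<Rightarrow> real ^ 'd ^ 'd::finite \<Rightarrow> bool"
  where "hamiltonian_matrix J b \<longleftrightarrow> transpose b ** J + J ** b = 0"

definition symplectic_matrix :: "real ^ 'd ^ 'd \<Rightarrow> real ^ 'd ^ 'd::finite \<Rightarrow> bool"
  where "symplectic_matrix J B \<longleftrightarrow> B ** J ** transpose B = J"

text \<open>For the map \<open>z\<^sub>0 \<mapsto> z\<^sub>h\<close> given implicitly by \<open>\<Psi> z\<^sub>0 z\<^sub>h = 0\<close> with \<open>z\<^sub>0\<close>, \<open>z\<^sub>h\<close> ranging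
  over the open set \<open>V\<close>; \<open>matrix_inv B2 ** B1\<close> is its derivative.\<close>

definition symplectic_implicit_map ::
    "real ^ 'd ^ 'd \<Rightarrow> (real ^ 'd) set \<Rightarrow> (real ^ 'd \<Rightarrow> real ^ 'd \<Rightarrow> real ^ 'd::finite) \<Rightarrow> bool"
  where "symplectic_implicit_map J V \<Psi> \<longleftrightarrow>
    (\<forall>z0\<in>V. \<forall>zh\<in>V. \<Psi> z0 zh = 0 \<longrightarrow>
      (let B1 = - jacobian (\<lambda>z. \<Psi> z zh) (at z0);
           B2 = jacobian (\<lambda>z. \<Psi> z0 z) (at zh)
       in invertible B2 \<longrightarrow> symplectic_matrix J (matrix_inv B2 ** B1)))"

definition rho :: "real ^ 'd ^ 'd \<Rightarrow> real ^ 'd \<Rightarrow> real ^ 'd \<Rightarrow> real ^ 'd::finite"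
  where "rho b z0 zh = (mat (1/2) - b) *v z0 + (mat (1/2) + b) *v zh"

end

theory Submission
  imports Defs
begin

text \<open>In the coordinates of the chart, \<open>\<omega>(X, v) = - dH(v)\<close> reads \<open>J X = - \<nabla>H\<close>. Symmetry of the
  Hessian of \<open>H\<close> therefore makes \<open>J A\<close> symmetric for the Jacobian \<open>A\<close> of \<open>X\<close>, that is, \<open>A\<close> is a
  Hamiltonian matrix. With \<open>K = h A\<close>, \<open>P = 1/2 - b\<close> and \<open>Q = 1/2 + b\<close> the amplification matrix is
  \<open>(1 - K Q)\<^sup>-\<^sup>1 (1 + K P)\<close>, so the claim is that \<open>1 + K P\<close> and \<open>1 - K Q\<close> transform \<open>J\<close> to
  the same matrix. The terms linear in \<open>K\<close> agree because \<open>P + Q = 1\<close> and \<open>K\<close> is Hamiltonian, the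
  quadratic ones because \<open>b\<close> is Hamiltonian.\<close>

section \<open>Symmetry of the second derivative\<close>

text \<open>The mean value theorem writes the second difference as \<open>t\<close> times a
  difference of two values of \<open>f'\<close> in direction \<open>u\<close>. Both values are
  compared with the linearization at \<open>z\<close>, and linearity of \<open>D\<close> leaves the
  main term \<open>t * D v\<close>.\<close>

lemma second_difference_quotient:
  fixes f :: "'a::real_normed_vector \<Rightarrow> real"
  assumes "open V" "z \<in> V"
    and f': "\<And>x. x \<in> V \<Longrightarrow> (f has_derivative f' x) (at x)"
    and D: "((\<lambda>x. f' x u) has_derivative D) (at z)"
    and "e > 0"
  obtains d where "d > 0"
    and "\<And>t. 0 < t \<Longrightarrow> t < d \<Longrightarrow>
      \<bar>f (z + t *\<^sub>R u + t *\<^sub>R v) - f (z + t *\<^sub>R u) - f (z + t *\<^sub>R v) + f z - t\<^sup>2 * D v\<bar> \<le> e * t\<^sup>2"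
proof -
  interpret D: bounded_linear D using D by (rule has_derivative_bounded_linear)
  \<comment> \<open>\<open>t * N\<close> bounds every displacement from \<open>z\<close> inside the
    parallelogram spanned by \<open>t *\<^sub>R u\<close> and \<open>t *\<^sub>R v\<close>; the
    summand 1 keeps \<open>N\<close> positive when \<open>u\<close> and \<open>v\<close>
    vanish.\<close>
  define N where "N = norm u + norm v + 1"
  have N: "N > 0" by (simp add: N_def add_nonneg_pos)
  obtain r where r: "r > 0" "ball z r \<subseteq> V" using \<open>open V\<close> \<open>z \<in> V\<close> open_contains_ball by blast
  \<comment> \<open>Two linearization errors, each at most \<open>e' * (t * N)\<close>, will add up
    to \<open>e * t\<close>.\<close>
  define e' where "e' = e / (2 * N)"
  have "e' > 0" using N \<open>e > 0\<close> by (simp add: e'_def)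
  then obtain d0 where d0: "d0 > 0"
    "\<And>y. norm (y - z) < d0 \<Longrightarrow> \<bar>f' y u - f' z u - D (y - z)\<bar> \<le> e' * norm (y - z)"
    using D unfolding has_derivative_at_alt real_norm_def by blast
  define d where "d = min r d0 / N"
  show ?thesis
  proof
    show "d > 0" using r d0 N by (simp add: d_def)
    fix t :: real assume t: "0 < t" "t < d"
    have tN: "t * N < min r d0" using t N by (simp add: d_def pos_less_divide_eq)
    have bound: "norm (s *\<^sub>R u + k *\<^sub>R v) \<le> t * N"
      if "0 \<le> s" "s \<le> t" "0 \<le> k" "k \<le> t" for s k
    proof -
      have "norm (s *\<^sub>R u + k *\<^sub>R v) \<le> s * norm u + k * norm v"
        using that norm_triangle_ineq[of "s *\<^sub>R u" "k *\<^sub>R v"] by simp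
      also have "\<dots> \<le> t * norm u + t * norm v"
        using that by (intro add_mono mult_right_mono) auto
      also have "\<dots> \<le> t * N" using t by (simp add: N_def algebra_simps)
      finally show ?thesis .
    qed
    have in_V: "z + (s *\<^sub>R u + k *\<^sub>R v) \<in> V" if "0 \<le> s" "s \<le> t" "0 \<le> k" "k \<le> t" for s k
    proof -
      have "dist z (z + (s *\<^sub>R u + k *\<^sub>R v)) < r"
        using bound[OF that] tN by (subst dist_commute) (simp add: dist_norm)
      then show ?thesis using r(2) by auto
    qed
    have first_order: "\<bar>f' (z + (s *\<^sub>R u + k *\<^sub>R v)) u - f' z u - D (s *\<^sub>R u + k *\<^sub>R v)\<bar> \<le> e' * (t * N)"
      if "0 \<le> s" "s \<le> t" "0 \<le> k" "k \<le> t" for s k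
      using d0(2)[of "z + (s *\<^sub>R u + k *\<^sub>R v)"] bound[OF that] tN \<open>e' > 0\<close>
      by (smt (verit) add_diff_cancel_left' mult_left_mono)
    \<comment> \<open>\<open>\<phi> t - \<phi> 0\<close> is the second difference. The vacuous
      \<open>0 *\<^sub>R v\<close> lets both terms be instances of \<open>slice\<close> and
      \<open>scale\<close>.\<close>
    define \<phi> where "\<phi> s = f (z + (s *\<^sub>R u + t *\<^sub>R v)) - f (z + (s *\<^sub>R u + 0 *\<^sub>R v))" for s
    have slice: "((\<lambda>s. f (z + (s *\<^sub>R u + k *\<^sub>R v))) has_derivative
        (\<lambda>a. f' (z + (s *\<^sub>R u + k *\<^sub>R v)) (a *\<^sub>R u))) (at s within {0..t})"
      if "0 \<le> s" "s \<le> t" "0 \<le> k" "k \<le> t" for s k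
    proof (rule has_derivative_compose[where g = f])
      show "(f has_derivative f' (z + (s *\<^sub>R u + k *\<^sub>R v))) (at (z + (s *\<^sub>R u + k *\<^sub>R v)))"
        by (rule f'[OF in_V[OF that]])
    qed (auto intro!: derivative_eq_intros)
    have "\<exists>s\<in>{0<..<t}. \<phi> t - \<phi> 0 =
        f' (z + (s *\<^sub>R u + t *\<^sub>R v)) ((t - 0) *\<^sub>R u) - f' (z + (s *\<^sub>R u + 0 *\<^sub>R v)) ((t - 0) *\<^sub>R u)"
      unfolding \<phi>_def
      by (rule mvt_simple, use t in simp, intro has_derivative_diff slice, use t in auto)
    then obtain s where s: "0 < s" "s < t" and eq: "\<phi> t - \<phi> 0 =
        f' (z + (s *\<^sub>R u + t *\<^sub>R v)) (t *\<^sub>R u) - f' (z + (s *\<^sub>R u + 0 *\<^sub>R v)) (t *\<^sub>R u)"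
      by auto
    have scale: "f' (z + (s *\<^sub>R u + k *\<^sub>R v)) (t *\<^sub>R u) = t * f' (z + (s *\<^sub>R u + k *\<^sub>R v)) u"
      if "0 \<le> k" "k \<le> t" for k
    proof -
      have "linear (f' (z + (s *\<^sub>R u + k *\<^sub>R v)))"
        using has_derivative_linear[OF f'[OF in_V[of s k]]] that s by simp
      then show ?thesis by (simp add: linear_scale)
    qed
    \<comment> \<open>The unknown intermediate point \<open>s\<close> drops out here: \<open>D (s
      *\<^sub>R u + t *\<^sub>R v) - D (s *\<^sub>R u) = t * D v\<close>.\<close>
    define E where "E = f' (z + (s *\<^sub>R u + t *\<^sub>R v)) u - f' (z + (s *\<^sub>R u + 0 *\<^sub>R v)) u - t * D v"
    have "\<bar>E\<bar> \<le> 2 * (e' * (t * N))"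
      using first_order[of s t] first_order[of s 0] s t unfolding E_def by (simp add: D.add D.scaleR)
    also have "\<dots> = e * t" using N by (simp add: e'_def field_simps)
    finally have "\<bar>t * E\<bar> \<le> e * t\<^sup>2"
      using t by (simp add: abs_mult power2_eq_square mult_left_mono mult.left_commute)
    moreover have "t * E = \<phi> t - \<phi> 0 - t\<^sup>2 * D v"
      using t scale[of t] scale[of 0] unfolding eq E_def by (simp add: algebra_simps power2_eq_square)
    ultimately show "\<bar>f (z + t *\<^sub>R u + t *\<^sub>R v) - f (z + t *\<^sub>R u) - f (z + t *\<^sub>R v) + f z - t\<^sup>2 * D v\<bar> \<le> e * t\<^sup>2"
      by (simp add: \<phi>_def algebra_simps)
  qed
qed

text \<open>The second difference is unchanged when \<open>u\<close> and \<open>v\<close> are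
  exchanged, so after division by \<open>t\<^sup>2\<close> it approximates both \<open>D v u\<close>
  and \<open>D u v\<close> as \<open>t\<close> tends to 0.\<close>

lemma second_derivative_symmetric:
  fixes f :: "'a::real_normed_vector \<Rightarrow> real"
  assumes "open V" "z \<in> V"
    and f': "\<And>x. x \<in> V \<Longrightarrow> (f has_derivative f' x) (at x)"
    and D: "\<And>v. ((\<lambda>x. f' x v) has_derivative (\<lambda>u. D u v)) (at z)"
  shows "D u v = D v u"
proof -
  \<comment> \<open>The summand 0 gives the bound the shape that \<open>field_le_epsilon\<close>
    expects.\<close>
  have "\<bar>D v u - D u v\<bar> \<le> 0 + e" if "e > 0" for e
  proof -
    have "e/2 > 0" using that by simp
    obtain d1 where d1: "d1 > 0" "\<And>t. 0 < t \<Longrightarrow> t < d1 \<Longrightarrow>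
      \<bar>f (z + t *\<^sub>R u + t *\<^sub>R v) - f (z + t *\<^sub>R u) - f (z + t *\<^sub>R v) + f z - t\<^sup>2 * D v u\<bar> \<le> e/2 * t\<^sup>2"
      using second_difference_quotient[OF assms(1,2) f' D \<open>e/2 > 0\<close>] by metis
    obtain d2 where d2: "d2 > 0" "\<And>t. 0 < t \<Longrightarrow> t < d2 \<Longrightarrow>
      \<bar>f (z + t *\<^sub>R v + t *\<^sub>R u) - f (z + t *\<^sub>R v) - f (z + t *\<^sub>R u) + f z - t\<^sup>2 * D u v\<bar> \<le> e/2 * t\<^sup>2"
      using second_difference_quotient[OF assms(1,2) f' D \<open>e/2 > 0\<close>] by metis
    define t where "t = min d1 d2 / 2"
    have t: "0 < t" "t < d1" "t < d2" using d1(1) d2(1) by (auto simp: t_def)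
    have "\<bar>t\<^sup>2 * D v u - t\<^sup>2 * D u v\<bar> \<le> e * t\<^sup>2"
      using d1(2)[OF t(1,2)] d2(2)[OF t(1,3)]
      unfolding add.assoc[of z] add.commute[of "t *\<^sub>R v"] by linarith
    then have "\<bar>t\<^sup>2 * (D v u - D u v)\<bar> \<le> t\<^sup>2 * e"
      by (simp only: right_diff_distrib mult.commute[of e])
    then show ?thesis using t(1) by (simp add: abs_mult)
  qed
  then have "\<bar>D v u - D u v\<bar> \<le> 0" by (rule field_le_epsilon)
  then show ?thesis by simp
qed

section \<open>Matrix algebra and congruences of \<open>J\<close>\<close>

lemma matrix_mul_add_left: "(A + B) ** C = A ** C + B ** (C :: real ^ 'c ^ 'b::finite)"
  by (simp add: matrix_matrix_mult_def vec_eq_iff sum.distrib distrib_right)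

lemma matrix_mul_minus_left: "(- A) ** B = - (A ** (B :: real ^ 'c ^ 'b::finite))"
  by (simp add: matrix_matrix_mult_def vec_eq_iff sum_negf)

lemma matrix_mul_minus_right: "A ** (- B) = - (A ** (B :: real ^ 'c ^ 'b::finite))"
  by (simp add: matrix_matrix_mult_def vec_eq_iff sum_negf)

lemma matrix_mul_diff_left: "(A - B) ** C = A ** C - B ** (C :: real ^ 'c ^ 'b::finite)"
  by (simp add: matrix_matrix_mult_def vec_eq_iff sum_subtractf left_diff_distrib)

lemma matrix_mul_diff_right: "A ** (B - C) = A ** B - A ** (C :: real ^ 'c ^ 'b::finite)"
  by (simp add: matrix_matrix_mult_def vec_eq_iff sum_subtractf right_diff_distrib)

lemma transpose_diff: "transpose (A - B) = transpose A - transpose (B :: real ^ 'c ^ 'b)"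
  by (simp add: transpose_def vec_eq_iff)

lemma transpose_add: "transpose (A + B) = transpose A + transpose (B :: real ^ 'c ^ 'b)"
  by (simp add: transpose_def vec_eq_iff)

lemma transpose_uminus: "transpose (- A) = - transpose (A :: real ^ 'c ^ 'b)"
  by (simp add: transpose_def vec_eq_iff)

lemmas matrix_distribs =
  matrix_add_ldistrib matrix_mul_add_left matrix_mul_diff_left matrix_mul_diff_right
  matrix_mul_minus_left matrix_mul_minus_right transpose_diff transpose_add transpose_uminus

text \<open>Multiplication by \<open>J\<close> on both sides, with \<open>J ** J = - mat 1\<close>,
  moves the transpose to the right-hand factor, where it stands in the congruence
  \<open>B ** J ** transpose B\<close>.\<close>

lemma hamiltonian_matrix_transpose:
  assumes "J ** J = - mat 1" "hamiltonian_matrix J K"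
  shows "K ** J + J ** transpose K = 0"
proof -
  have "J ** (transpose K ** J + J ** K) ** J = 0"
    using assms(2) by (simp add: hamiltonian_matrix_def)
  then have "J ** transpose K ** (J ** J) + (J ** J) ** K ** J = 0"
    by (simp add: matrix_add_ldistrib matrix_mul_add_left matrix_mul_assoc)
  then have "- (K ** J) = J ** transpose K"
    by (simp add: assms(1) matrix_distribs eq_neg_iff_add_eq_0 add.commute)
  then show ?thesis by (metis add.right_inverse)
qed

text \<open>Reversing the sign of \<open>b\<close> affects only the terms linear in
  \<open>b\<close>, which sum to a multiple of \<open>b ** J + J ** transpose b = 0\<close>.\<close>

lemma half_add_mult_half_add:
  fixes J b :: "real ^ 'd ^ 'd"
  assumes "b ** J + J ** transpose b = 0"
  shows "(mat (1/2) - b) ** J ** transpose (mat (1/2) - b)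
    = (mat (1/2) + b) ** J ** transpose (mat (1/2) + b)"
proof -
  have half: "mat (1/2) = (1/2) *\<^sub>R (mat 1 :: real ^ 'd ^ 'd)"
    by (simp add: mat_def vec_eq_iff)
  have "b ** J = - (J ** transpose b)"
    using assms by (simp add: eq_neg_iff_add_eq_0)
  then show ?thesis
    by (simp add: half matrix_distribs transpose_scalar matrix_scalar_ac flip: scalar_matrix_assoc)
      (simp add: vec_eq_iff field_simps)
qed

lemma amplification_factors_congruent:
  fixes J K P Q :: "real ^ 'd ^ 'd"
  assumes PQ: "P + Q = mat 1"
    and P: "P ** J ** transpose P = Q ** J ** transpose Q"
    and K: "K ** J + J ** transpose K = 0"
  shows "(mat 1 + K ** P) ** J ** transpose (mat 1 + K ** P)
    = (mat 1 - K ** Q) ** J ** transpose (mat 1 - K ** Q)"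
proof -
  \<comment> \<open>Inserting \<open>P + Q\<close>, the identity, into the relation for
    \<open>K\<close> splits it into the linear terms of the two congruences.\<close>
  have "K ** (P + Q) ** J + J ** transpose (P + Q) ** transpose K = 0"
    using K by (simp add: PQ)
  then have lin: "K ** P ** J + J ** transpose P ** transpose K
      = - (K ** Q ** J + J ** transpose Q ** transpose K)"
    by (simp add: matrix_distribs eq_neg_iff_add_eq_0 algebra_simps)
  have "K ** (P ** J ** transpose P) ** transpose K = K ** (Q ** J ** transpose Q) ** transpose K"
    by (simp only: P)
  then have quad: "K ** P ** J ** transpose P ** transpose K = K ** Q ** J ** transpose Q ** transpose K"
    by (simp add: matrix_mul_assoc)
  have "(mat 1 + K ** P) ** J ** transpose (mat 1 + K ** P)
      = J + (K ** P ** J + J ** transpose P ** transpose K) + K ** P ** J ** transpose P ** transpose K"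
    by (simp add: matrix_distribs matrix_transpose_mul matrix_mul_assoc)
  also have "\<dots> = J + - (K ** Q ** J + J ** transpose Q ** transpose K)
      + K ** Q ** J ** transpose Q ** transpose K"
    by (simp only: lin quad)
  also have "\<dots> = (mat 1 - K ** Q) ** J ** transpose (mat 1 - K ** Q)"
    by (simp add: matrix_distribs matrix_transpose_mul matrix_mul_assoc)
  finally show ?thesis .
qed

lemma matrix_inv_left: "invertible A \<Longrightarrow> matrix_inv A ** A = mat 1"
  unfolding invertible_def matrix_inv_def by (rule someI2_ex) auto

text \<open>Congruence by \<open>matrix_inv B2\<close> turns the right-hand side of the assumption
  into \<open>J\<close>, so symplecticity reduces to an identity free of inverses.\<close>

lemma symplectic_matrix_quotient:
  assumes "invertible B2" "B1 ** J ** transpose B1 = B2 ** J ** transpose B2"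
  shows "symplectic_matrix J (matrix_inv B2 ** B1)"
proof -
  let ?C = "matrix_inv B2"
  have C: "?C ** B2 = mat 1" using assms(1) by (rule matrix_inv_left)
  have "(?C ** B1) ** J ** transpose (?C ** B1) = ?C ** (B1 ** J ** transpose B1) ** transpose ?C"
    by (simp add: matrix_transpose_mul matrix_mul_assoc)
  also have "\<dots> = (?C ** B2) ** J ** transpose (?C ** B2)"
    unfolding assms(2) by (simp add: matrix_transpose_mul matrix_mul_assoc)
  also have "\<dots> = J" by (simp add: C)
  finally show ?thesis by (simp add: symplectic_matrix_def)
qed

section \<open>Hamiltonian vector fields in coordinates\<close>

text \<open>The two halves of the wedge give equal contributions because \<open>J\<close> is
  antisymmetric, which cancels the factor 1/2. The inner product form lets the gradient of the
  Hamiltonian be read off.\<close>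

lemma const_two_form_eq_inner:
  assumes "transpose J = - J"
  shows "const_two_form J u v = (J *v u) \<bullet> v"
proof -
  have J: "J $ i $ j = - J $ j $ i" for i j
  proof -
    have "transpose J $ j $ i = (- J) $ j $ i" by (simp only: assms)
    then show ?thesis by (simp add: transpose_def)
  qed
  let ?S = "\<Sum>i\<in>UNIV. \<Sum>j\<in>UNIV. J $ i $ j * (u $ j * v $ i)"
  let ?T = "\<Sum>i\<in>UNIV. \<Sum>j\<in>UNIV. J $ i $ j * (u $ i * v $ j)"
  have "?T = (\<Sum>i\<in>UNIV. \<Sum>j\<in>UNIV. J $ j $ i * (u $ j * v $ i))"
    by (rule sum.swap)
  also have "\<dots> = (\<Sum>i\<in>UNIV. \<Sum>j\<in>UNIV. - (J $ i $ j * (u $ j * v $ i)))"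
  proof (intro sum.cong refl)
    show "J $ j $ i * (u $ j * v $ i) = - (J $ i $ j * (u $ j * v $ i))" for i j
      using J[of j i] by simp
  qed
  finally have "?T = - ?S"
    by (simp only: sum_negf)
  moreover have "const_two_form J u v = (\<Sum>i\<in>UNIV. \<Sum>j\<in>UNIV.
      1/2 * (J $ i $ j * (u $ j * v $ i)) - 1/2 * (J $ i $ j * (u $ i * v $ j)))"
    unfolding const_two_form_def wedge_def by (intro sum.cong refl) (simp add: algebra_simps)
  then have "const_two_form J u v = 1/2 * ?S - 1/2 * ?T"
    by (simp only: sum_subtractf sum_distrib_left)
  ultimately have "const_two_form J u v = ?S"
    by simp
  then show ?thesis
    by (simp add: matrix_vector_mult_def inner_vec_def sum_distrib_right mult.assoc)
qed

text \<open>The gradient of \<open>f\<close> is \<open>- (J *v Y x)\<close>, so its Hessian at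
  \<open>w\<close> is \<open>- (J ** K)\<close>. Its symmetry, combined with
  \<open>transpose J = - J\<close>, is the Hamiltonian condition on \<open>K\<close>.\<close>

lemma hamiltonian_matrix_jacobian:
  fixes Y :: "real ^ 'd \<Rightarrow> real ^ 'd::finite" and f :: "real ^ 'd \<Rightarrow> real"
  assumes "open V" "w \<in> V" "transpose J = - J"
    and f: "\<And>x. x \<in> V \<Longrightarrow> (f has_derivative (\<lambda>v. - ((J *v Y x) \<bullet> v))) (at x)"
    and Y: "(Y has_derivative (*v) K) (at w)"
  shows "hamiltonian_matrix J K"
proof -
  have "- ((J *v (K *v u)) \<bullet> v) = - ((J *v (K *v v)) \<bullet> u)" for u v
  proof (rule second_derivative_symmetric[OF \<open>open V\<close> \<open>w \<in> V\<close> f,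
        where D = "\<lambda>u v. - ((J *v (K *v u)) \<bullet> v)"])
    have JY: "((\<lambda>x. J *v Y x) has_derivative (\<lambda>u. J *v (K *v u))) (at w)"
      by (rule bounded_linear.has_derivative[OF matrix_vector_mul_bounded_linear Y])
    show "((\<lambda>x. - ((J *v Y x) \<bullet> v)) has_derivative (\<lambda>u. - ((J *v (K *v u)) \<bullet> v))) (at w)" for v
      by (rule has_derivative_minus[OF has_derivative_inner_left[OF JY]])
  qed
  then have "((J ** K) *v u) \<bullet> v = (transpose (J ** K) *v u) \<bullet> v" for u v
    by (metis dot_lmul_matrix inner_commute matrix_vector_mul_assoc neg_equal_iff_equal
        transpose_matrix_vector)
  then have "transpose (J ** K) = J ** K"
    by (metis matrix_eq vector_eq_rdot)
  then have "J ** K = - (transpose K ** J)"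
    using assms(3) by (simp add: matrix_transpose_mul matrix_distribs)
  then show ?thesis by (simp add: hamiltonian_matrix_def)
qed

lemma matrix_vector_mult_minus_left: "(- A) *v x = - (A *v (x :: real ^ 'b::finite))"
  by (simp add: matrix_vector_mult_def vec_eq_iff sum_negf)

lemma jacobian_eq:
  fixes K :: "real ^ 'b::finite ^ 'c::finite"
  shows "(f has_derivative (*v) K) (at x) \<Longrightarrow> jacobian f (at x) = K"
  by (simp add: jacobian_def flip: frechet_derivative_at)

section \<open>The implicit scheme in coordinates\<close>

text \<open>Here \<open>f\<close> stands for the Hamiltonian and \<open>Y\<close> for its vector
  field in coordinates. Both partial Jacobians of the scheme involve the Jacobian of
  \<open>Y\<close> at the same point \<open>w\<close>, which is what makes the congruence lemma
  applicable.\<close>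

lemma symplectic_implicit_rho:
  fixes Y :: "real ^ 'd \<Rightarrow> real ^ 'd::finite" and f :: "real ^ 'd \<Rightarrow> real"
  assumes "open V" and J: "transpose J = - J" "J ** J = - mat 1"
    and f: "\<And>x. x \<in> V \<Longrightarrow> (f has_derivative (\<lambda>v. - ((J *v Y x) \<bullet> v))) (at x)"
    and Y: "\<And>x. x \<in> V \<Longrightarrow> Y differentiable at x"
    and b: "hamiltonian_matrix J b"
    and rho_V: "\<And>z0 zh. z0 \<in> V \<Longrightarrow> zh \<in> V \<Longrightarrow> rho b z0 zh \<in> V"
  shows "symplectic_implicit_map J V (\<lambda>z0 zh. zh - z0 - h *\<^sub>R Y (rho b z0 zh))"
  unfolding symplectic_implicit_map_def Let_def
proof (intro ballI impI)
  fix z0 zh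
  let ?\<Psi> = "\<lambda>z0 zh. zh - z0 - h *\<^sub>R Y (rho b z0 zh)"
  let ?B2 = "jacobian (?\<Psi> z0) (at zh)"
  assume z: "z0 \<in> V" "zh \<in> V" and inv: "invertible ?B2"
  define w where "w = rho b z0 zh"
  define A where "A = jacobian Y (at w)"
  define P where "P = mat (1/2) - b"
  define Q where "Q = mat (1/2) + b"
  have "w \<in> V" using rho_V z by (simp add: w_def)
  then have A: "(Y has_derivative (*v) A) (at w)"
    using Y jacobian_works unfolding A_def by blast
  have "(rho b z0 has_derivative (*v) Q) (at zh)"
    unfolding rho_def[abs_def] Q_def
    by (auto intro!: derivative_eq_intros bounded_linear.has_derivative[OF matrix_vector_mul_bounded_linear])
  \<comment> \<open>Chain rule through \<open>w\<close>; the 0 in the result is the derivative of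
    the fixed starting point.\<close>
  from has_derivative_compose[OF this] A
  have "(?\<Psi> z0 has_derivative (\<lambda>v. v - 0 - h *\<^sub>R (A *v (Q *v v)))) (at zh)"
    unfolding w_def by (intro has_derivative_diff has_derivative_scaleR_right has_derivative_ident has_derivative_const) auto
  also have "(\<lambda>v. v - 0 - h *\<^sub>R (A *v (Q *v v))) = (*v) (mat 1 - (h *\<^sub>R A) ** Q)"
    by (simp add: fun_eq_iff matrix_vector_mult_diff_rdistrib scaleR_matrix_vector_assoc flip: matrix_vector_mul_assoc)
  finally have B2: "?B2 = mat 1 - (h *\<^sub>R A) ** Q" by (rule jacobian_eq)
  have "((\<lambda>z. rho b z zh) has_derivative (*v) P) (at z0)"
    unfolding rho_def[abs_def] P_def
    by (auto intro!: derivative_eq_intros bounded_linear.has_derivative[OF matrix_vector_mul_bounded_linear])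
  from has_derivative_compose[OF this] A
  have "((\<lambda>z. ?\<Psi> z zh) has_derivative (\<lambda>v. 0 - v - h *\<^sub>R (A *v (P *v v)))) (at z0)"
    unfolding w_def by (intro has_derivative_diff has_derivative_scaleR_right has_derivative_ident has_derivative_const) auto
  also have "(\<lambda>v. 0 - v - h *\<^sub>R (A *v (P *v v))) = (*v) (- mat 1 - (h *\<^sub>R A) ** P)"
    by (simp add: fun_eq_iff matrix_vector_mult_diff_rdistrib matrix_vector_mult_minus_left
        scaleR_matrix_vector_assoc flip: matrix_vector_mul_assoc)
  finally have B1: "- jacobian (\<lambda>z. ?\<Psi> z zh) (at z0) = mat 1 + (h *\<^sub>R A) ** P"
    by (simp add: jacobian_eq)
  have "hamiltonian_matrix J A"
    by (rule hamiltonian_matrix_jacobian[OF \<open>open V\<close> \<open>w \<in> V\<close> J(1) f A])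
  then have "A ** J + J ** transpose A = 0"
    by (rule hamiltonian_matrix_transpose[OF J(2)])
  then have K: "(h *\<^sub>R A) ** J + J ** transpose (h *\<^sub>R A) = 0"
    by (simp add: transpose_scalar matrix_scalar_ac flip: scalar_matrix_assoc scaleR_add_right)
  have PQ: "P + Q = mat 1" by (simp add: P_def Q_def mat_def vec_eq_iff)
  show "symplectic_matrix J (matrix_inv ?B2 ** - jacobian (\<lambda>z. ?\<Psi> z zh) (at z0))"
    using inv amplification_factors_congruent[OF PQ _ K]
      half_add_mult_half_add[OF hamiltonian_matrix_transpose[OF J(2) b]]
    unfolding B1 B2 P_def Q_def by (intro symplectic_matrix_quotient) auto
qed

section \<open>Passage from the manifold to a chart\<close>

lemma smooth_on_imp_differentiable: "smooth_on S f \<Longrightarrow> x \<in> S \<Longrightarrow> f differentiable at x"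
  using Ck_on.simps(2)[of 0 S f] unfolding smooth_on_def by blast

text \<open>A chart is a homeomorphism onto an open set: injectivity makes \<open>chart_inv\<close>
  a left inverse, and an image that is relatively open in the open range is open.\<close>

lemma
  assumes "is_chart M c"
  shows is_chart_chart_inv: "p \<in> chart_dom c \<Longrightarrow> chart_inv c (chart_map c p) = p"
    and is_chart_open_image: "openin M U \<Longrightarrow> U \<subseteq> chart_dom c \<Longrightarrow> open (chart_map c ` U)"
proof -
  have c: "openin M (chart_dom c)" "open (chart_map c ` chart_dom c)"
    "homeomorphic_map (subtopology M (chart_dom c))
      (top_of_set (chart_map c ` chart_dom c)) (chart_map c)"
    using assms by (auto simp: is_chart_def)
  have "inj_on (chart_map c) (chart_dom c)"
    using homeomorphic_imp_injective_map[OF c(3)] openin_subset[OF c(1)] by (simp add: inf_absorb2)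
  then show "p \<in> chart_dom c \<Longrightarrow> chart_inv c (chart_map c p) = p"
    by (simp add: chart_inv_def)
  assume "openin M U" "U \<subseteq> chart_dom c"
  then have "openin (subtopology M (chart_dom c)) U"
    using c(1) openin_open_subtopology by blast
  then have "openin (top_of_set (chart_map c ` chart_dom c)) (chart_map c ` U)"
    using homeomorphic_imp_open_map[OF c(3)] by (simp add: open_map_def)
  then show "open (chart_map c ` U)" using c(2) openin_open_trans by blast
qed

theorem theorem8p1:
  fixes M :: "'m topology"
    and A :: "('m, 'd::finite) chart set"
    and \<theta> :: "('m, 'd) form1"
    and \<omega> :: "('m, 'd) form2"
    and H :: "'m \<Rightarrow> real"
    and X :: "('m, 'd) vfield"
    and c :: "('m, 'd) chart"
    and U :: "'m set"
    and J b :: "real ^ 'd ^ 'd"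
    and h :: real
    and n :: nat
    and \<gamma> :: "real \<Rightarrow> 'm"
  assumes "CARD('d) = 2 * n"
    and "exact_symplectic_manifold M A \<theta> \<omega>"
    and "smooth_function A H"
    and "hamiltonian_vector_field A \<omega> H X"
    and "c \<in> A" and "openin M U" and "U \<subseteq> chart_dom c" and "convex (chart_map c ` U)"
    and "transpose J = - J" and "J ** J = - mat 1"
    and "\<And>p. p \<in> U \<Longrightarrow> \<omega> c p = const_two_form J"
    and "integral_curve M A X (closed_segment 0 h) \<gamma>" and "\<gamma> 0 \<in> U" and "\<gamma> h \<in> U"
    and "hamiltonian_matrix J b"
    and "\<And>z0 zh. z0 \<in> chart_map c ` U \<Longrightarrow> zh \<in> chart_map c ` U
           \<Longrightarrow> rho b z0 zh \<in> chart_map c ` U"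
  shows "symplectic_implicit_map J (chart_map c ` U)
           (\<lambda>z0 zh. zh - z0 - h *\<^sub>R X c (chart_inv c (rho b z0 zh)))"
proof (rule symplectic_implicit_rho[where f = "H \<circ> chart_inv c"])
  \<comment> \<open>The role of \<open>Y\<close> is played by \<open>X\<close> read in the chart
    \<open>c\<close>, that of \<open>V\<close> by the coordinate image of \<open>U\<close>.\<close>
  have chart: "is_chart M c"
    using assms(2,5) by (auto simp: exact_symplectic_manifold_def smooth_manifold_def)
  show "open (chart_map c ` U)" by (rule is_chart_open_image[OF chart assms(6,7)])
  fix x assume "x \<in> chart_map c ` U"
  then obtain p where p: "p \<in> U" "x = chart_map c p" by blast
  then have p_dom: "p \<in> chart_dom c" and inv: "chart_inv c x = p"
    using assms(7) is_chart_chart_inv[OF chart] by auto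
  then have x_dom: "x \<in> chart_map c ` chart_dom c" using p(2) by blast
  show "(\<lambda>x. X c (chart_inv c x)) differentiable at x"
    using assms(4,5) smooth_on_imp_differentiable[OF _ x_dom]
    by (auto simp: hamiltonian_vector_field_def vector_field_def comp_def)
  \<comment> \<open>This is Hamilton's equation at \<open>p\<close>, with the constant two-form
    written as an inner product.\<close>
  have "frechet_derivative (H \<circ> chart_inv c) (at x) v = - ((J *v X c (chart_inv c x)) \<bullet> v)" for v
  proof -
    have "\<omega> c p (X c p) v = - differential H c p v"
      using assms(4,5) p_dom by (auto simp: hamiltonian_vector_field_def)
    then show ?thesis
      using assms(11)[OF p(1)] const_two_form_eq_inner[OF assms(9)] p(2) inv
      by (simp add: differential_def)
  qed
  moreover have "(H \<circ> chart_inv c) differentiable at x"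
    using assms(3,5) smooth_on_imp_differentiable[OF _ x_dom] by (auto simp: smooth_function_def)
  ultimately show "((H \<circ> chart_inv c) has_derivative (\<lambda>v. - ((J *v X c (chart_inv c x)) \<bullet> v))) (at x)"
    by (metis (no_types, lifting) ext frechet_derivative_works)
qed (use assms in auto)

end
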